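(* Let $U_{\vec a,\sigma}$ be a totally umbilical surface of hyperbolic space $\mathbb{H}^3$ with mean curvature $H$, and let $\alpha\colon I\subset\mathbb{R}\to\mathbb{H}^3$ be a regular curve with curvature $\kappa$ and torsion $\tau$. (1) Case $\sigma=0$. If $\alpha$ is contained in $U_{\vec a,0}$, then $\tau=0$ identically on $I$. (2) Case $\sigma\neq 0$. If $\alpha$ is contained in $U_{\vec a,\sigma}$ and $\tau\neq 0$ everywhere on $I$, then $$\frac{1}{\kappa^2}+\frac{\kappa'^2}{\kappa^4\tau^2}=\frac{1}{H^2}\quad\text{on } I.$$ Conversely: if $\tau=0$ identically on $I$, then $\alpha$ is contained in a totally geodesic plane of $\mathbb{H}^3$. If $\tau\neq0$ and $\kappa'\neq 0$ everywhere on $I$ and there is a constant $C>0$ such that $$\frac{1}{\kappa^2}+\frac{\kappa'^2}{\kappa^4\tau^2}=C\quad\text{on } I,$$ then $\alpha$ is contained in a totally umbilical surface of $\mathbb{H}^3$ whose mean curvature $H$ satisfies $C=1/H^2$; this surface is an equidistant surface if $C>1$, a horosphere if $C=1$, and a geodesic sphere if $C<1$.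
   Context: Model: endow $\mathbb{R}^4$ with the Lorentzian metric $\langle\cdot,\cdot\rangle=dx_1^2+dx_2^2+dx_3^2-dx_4^2$. Hyperbolic space is $\mathbb{H}^3=\{p\in\mathbb{R}^4:\langle p,p\rangle=-1,\ x_4>0\}$ with the induced Riemannian metric and Levi-Civita connection $\nabla$. Totally umbilical surfaces: these are the (nonempty) sets $U_{\vec a,\sigma}=\{p\in\mathbb{H}^3:\langle p,\vec a\rangle=\sigma\}$ with $\sigma\in\mathbb{R}$, $\vec a\in\mathbb{R}^4$, $\vec a\neq0$, $\langle\vec a,\vec a\rangle=\epsilon\in\{-1,0,1\}$, of one of the following types: totally geodesic planes ($\epsilon=1$, $\sigma=0$); equidistant surfaces ($\epsilon=1$, $\sigma\neq0$); horospheres ($\epsilon=0$, $\sigma\neq0$); geodesic spheres ($\epsilon=-1$, $|\sigma|>1$). With respect to the unit normal $\xi(p)=-(\vec a+\sigma p)/\sqrt{\epsilon+\sigma^2}$, the mean curvature (the common value of the principal curvatures) is the constant $H=\sigma/\sqrt{\epsilon+\sigma^2}$. Curves: $I$ is an open interval; curves are of class at least $C^4$, parametrized by arc length $s$, and non-geodesic in the sense that $\kappa>0$ everywhere. The prime denotes $d/ds$. The curvature $\kappa$ and torsion $\tau$ are defined by the Frenet frame $\{T,N,B\}$ (orthonormal frame of $\mathbb{H}^3$ along $\alpha$, $T=\alpha'$, positively oriented for a fixed orientation) with $\nabla_TT=\kappa N$, $\nabla_TN=-\kappa T+\tau B$, $\nabla_TB=-\tau N$. "$\alpha$ is contained in $S$"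 means $\alpha(I)\subset S$. *)

theory Defs
  imports "HOL-Analysis.Analysis"
begin

definition lorentz :: "real^4 \<Rightarrow> real^4 \<Rightarrow> real" where
  "lorentz x y = x$1 * y$1 + x$2 * y$2 + x$3 * y$3 - x$4 * y$4"

definition hyp3 :: "(real^4) set" where
  "hyp3 = {p. lorentz p p = -1 \<and> p$4 > 0}"

text \<open>
  The Lorentz-orthogonal projection of \<open>\<real>\<^sup>4\<close> onto the tangent space
  \<open>{v. lorentz v p = 0}\<close> of hyperbolic space at \<open>p\<close> (recall \<open>lorentz p p = -1\<close>).  The
  Levi-Civita connection of the induced metric is the flat derivative of \<open>\<real>\<^sup>4\<close> followed
  by this projection.
\<close>

definition tproj :: "real^4 \<Rightarrow> real^4 \<Rightarrow> real^4" where
  "tproj p v = v + lorentz v p *\<^sub>R p"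

definition cov_deriv :: "(real \<Rightarrow> real^4) \<Rightarrow> (real \<Rightarrow> real^4) \<Rightarrow> real \<Rightarrow> real^4" where
  "cov_deriv \<alpha> V s = tproj (\<alpha> s) (vector_derivative V (at s))"

definition umb :: "real^4 \<Rightarrow> real \<Rightarrow> (real^4) set" where
  "umb a \<sigma> = {p \<in> hyp3. lorentz p a = \<sigma>}"

definition geodesic_plane :: "real^4 \<Rightarrow> real \<Rightarrow> bool" where
  "geodesic_plane a \<sigma> \<longleftrightarrow> lorentz a a = 1 \<and> \<sigma> = 0"

definition equidistant_surface :: "real^4 \<Rightarrow> real \<Rightarrow> bool" where
  "equidistant_surface a \<sigma> \<longleftrightarrow> lorentz a a = 1 \<and> \<sigma> \<noteq> 0"

definition horosphere :: "real^4 \<Rightarrow> real \<Rightarrow> bool" where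
  "horosphere a \<sigma> \<longleftrightarrow> lorentz a a = 0 \<and> \<sigma> \<noteq> 0"

definition geodesic_sphere :: "real^4 \<Rightarrow> real \<Rightarrow> bool" where
  "geodesic_sphere a \<sigma> \<longleftrightarrow> lorentz a a = -1 \<and> \<bar>\<sigma>\<bar> > 1"

definition totally_umbilical :: "real^4 \<Rightarrow> real \<Rightarrow> bool" where
  "totally_umbilical a \<sigma> \<longleftrightarrow> a \<noteq> 0 \<and> umb a \<sigma> \<noteq> {} \<and>
     (geodesic_plane a \<sigma> \<or> equidistant_surface a \<sigma> \<or> horosphere a \<sigma> \<or> geodesic_sphere a \<sigma>)"

definition umb_normal :: "real^4 \<Rightarrow> real \<Rightarrow> real^4 \<Rightarrow> real^4" where
  "umb_normal a \<sigma> p = - ((1 / sqrt (lorentz a a + \<sigma>\<^sup>2)) *\<^sub>R (a + \<sigma> *\<^sub>R p))"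

definition umb_tangent :: "real^4 \<Rightarrow> real^4 \<Rightarrow> (real^4) set" where
  "umb_tangent a p = {v. lorentz v p = 0 \<and> lorentz v a = 0}"

definition shape_op :: "real^4 \<Rightarrow> real \<Rightarrow> real^4 \<Rightarrow> real^4 \<Rightarrow> real^4" where
  "shape_op a \<sigma> p v = - tproj p (frechet_derivative (umb_normal a \<sigma>) (at p) v)"

definition principal_curvature :: "real^4 \<Rightarrow> real \<Rightarrow> real^4 \<Rightarrow> real \<Rightarrow> bool" where
  "principal_curvature a \<sigma> p k \<longleftrightarrow>
     (\<exists>v \<in> umb_tangent a p. v \<noteq> 0 \<and> shape_op a \<sigma> p v = k *\<^sub>R v)"

text \<open>Mean curvature as the common value of all the principal curvatures at all points.\<close>

definition has_mean_curvature :: "real^4 \<Rightarrow> real \<Rightarrow> real \<Rightarrow> bool" where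
  "has_mean_curvature a \<sigma> H \<longleftrightarrow>
     (\<forall>p \<in> umb a \<sigma>. {k. principal_curvature a \<sigma> p k} = {H})"

lemma has_mean_curvature_iff:
  assumes "totally_umbilical a \<sigma>"
  shows "has_mean_curvature a \<sigma> H \<longleftrightarrow> H = \<sigma> / sqrt (lorentz a a + \<sigma>\<^sup>2)"
proof -
  define c where "c = 1 / sqrt (lorentz a a + \<sigma>\<^sup>2)"
  have shape: "shape_op a \<sigma> p v = (\<sigma> / sqrt (lorentz a a + \<sigma>\<^sup>2)) *\<^sub>R v"
    if v: "v \<in> umb_tangent a p" for p v
  proof -
    have "(umb_normal a \<sigma> has_derivative (\<lambda>v. - (c *\<^sub>R (\<sigma> *\<^sub>R v)))) (at p)"
      unfolding umb_normal_def [abs_def] c_def by (auto intro!: derivative_eq_intros)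
    then have "frechet_derivative (umb_normal a \<sigma>) (at p) v = - ((c * \<sigma>) *\<^sub>R v)"
      using frechet_derivative_at by (metis scaleR_scaleR)
    moreover have "lorentz (- ((c * \<sigma>) *\<^sub>R v)) p = - (c * \<sigma>) * lorentz v p"
      by (simp add: lorentz_def algebra_simps)
    ultimately show ?thesis
      using v by (simp add: shape_op_def tproj_def umb_tangent_def c_def)
  qed
  have nz: "\<exists>v \<in> umb_tangent a p. v \<noteq> 0" for p
  proof -
    define J :: "real^4 \<Rightarrow> real^4" where "J x = (\<chi> i. if i = 4 then - x$i else x$i)" for x
    have J: "lorentz v x = J x \<bullet> v" for v x
      by (simp add: lorentz_def J_def inner_vec_def sum_4 mult.commute)
    have "dim {J p, J a} \<le> card {J p, J a}"
      by (rule dim_le_card) (auto simp: span_base)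
    also have "\<dots> \<le> 2"
      by (simp add: card_insert_if)
    finally have "dim {J p, J a} < DIM(real^4)"
      by simp
    then obtain v where v: "v \<noteq> 0" "\<And>y. y \<in> span {J p, J a} \<Longrightarrow> orthogonal v y"
      using orthogonal_to_subspace_exists by blast
    then have "orthogonal v (J p)" "orthogonal v (J a)"
      by (simp_all add: span_base)
    then have "v \<in> umb_tangent a p"
      by (simp add: umb_tangent_def J orthogonal_def inner_commute)
    with v show ?thesis by blast
  qed
  have "{k. principal_curvature a \<sigma> p k} = {\<sigma> / sqrt (lorentz a a + \<sigma>\<^sup>2)}" for p
    using nz [of p] by (auto simp: principal_curvature_def shape)
  with assms show ?thesis
    by (auto simp: has_mean_curvature_def totally_umbilical_def)
qed

text \<open>Class \<open>C\<^sup>n\<close> on an open set of parameters.\<close>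

primrec Cn_on :: "nat \<Rightarrow> (real \<Rightarrow> real^4) \<Rightarrow> real set \<Rightarrow> bool" where
  "Cn_on 0 f S \<longleftrightarrow> continuous_on S f"
| "Cn_on (Suc n) f S \<longleftrightarrow>
     (\<forall>s\<in>S. f differentiable (at s)) \<and> Cn_on n (\<lambda>s. vector_derivative f (at s)) S"

definition arclength_curve :: "real set \<Rightarrow> (real \<Rightarrow> real^4) \<Rightarrow> bool" where
  "arclength_curve I \<alpha> \<longleftrightarrow>
     open I \<and> is_interval I \<and> I \<noteq> {} \<and> Cn_on 4 \<alpha> I \<and> \<alpha> ` I \<subseteq> hyp3 \<and>
     (\<forall>s\<in>I. lorentz (vector_derivative \<alpha> (at s)) (vector_derivative \<alpha> (at s)) = 1)"

text \<open>
  Hyperbolic space is oriented by declaring a basis \<open>u, v, w\<close> of the tangent space at \<open>p\<close>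
  positive iff \<open>u, v, w, p\<close> is a positive basis of \<open>\<real>\<^sup>4\<close>.
\<close>

definition frenet_frame ::
  "real set \<Rightarrow> (real \<Rightarrow> real^4) \<Rightarrow> (real \<Rightarrow> real^4) \<Rightarrow> (real \<Rightarrow> real^4) \<Rightarrow> (real \<Rightarrow> real^4)
     \<Rightarrow> (real \<Rightarrow> real) \<Rightarrow> (real \<Rightarrow> real) \<Rightarrow> bool" where
  "frenet_frame I \<alpha> T N B \<kappa> \<tau> \<longleftrightarrow> (\<forall>s\<in>I.
     T s = vector_derivative \<alpha> (at s) \<and>
     lorentz (T s) (\<alpha> s) = 0 \<and> lorentz (N s) (\<alpha> s) = 0 \<and> lorentz (B s) (\<alpha> s) = 0 \<and>
     lorentz (T s) (T s) = 1 \<and> lorentz (N s) (N s) = 1 \<and> lorentz (B s) (B s) = 1 \<and>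
     lorentz (T s) (N s) = 0 \<and> lorentz (T s) (B s) = 0 \<and> lorentz (N s) (B s) = 0 \<and>
     det (vector [T s, N s, B s, \<alpha> s] :: real^4^4) > 0 \<and>
     T differentiable (at s) \<and> N differentiable (at s) \<and> B differentiable (at s) \<and>
     cov_deriv \<alpha> T s = \<kappa> s *\<^sub>R N s \<and>
     cov_deriv \<alpha> N s = - \<kappa> s *\<^sub>R T s + \<tau> s *\<^sub>R B s \<and>
     cov_deriv \<alpha> B s = - \<tau> s *\<^sub>R N s)"

text \<open>The condition \<open>\<kappa> > 0\<close> expresses that the curve is non-geodesic; it makes \<open>N\<close>, \<open>B\<close>,
  \<open>\<kappa>\<close> and \<open>\<tau>\<close> unique on \<open>I\<close>.\<close>

definition has_curvature_torsion ::
  "real set \<Rightarrow> (real \<Rightarrow> real^4) \<Rightarrow> (real \<Rightarrow> real) \<Rightarrow> (real \<Rightarrow> real) \<Rightarrow> bool" where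
  "has_curvature_torsion I \<alpha> \<kappa> \<tau> \<longleftrightarrow>
     (\<exists>T N B. frenet_frame I \<alpha> T N B \<kappa> \<tau>) \<and> (\<forall>s\<in>I. \<kappa> s > 0)"

end

theory Submission
  imports Defs
begin

text \<open>
  Differentiating in \<open>\<real>\<^sup>4\<close> rather than in hyperbolic space turns the Frenet equations into the
  linear system \<open>\<alpha>' = T\<close>, \<open>T' = \<kappa> N + \<alpha>\<close>, \<open>N' = - \<kappa> T + \<tau> B\<close>, \<open>B' = - \<tau> N\<close>, and
  \<open>T, N, B, \<alpha>\<close> is at each parameter a basis of \<open>\<real>\<^sup>4\<close>, orthonormal for the Lorentz form with
  \<open>\<alpha>\<close> timelike.  A curve lies in an umbilical surface iff its position vector has constant
  product with a constant vector \<open>a\<close>, so everything is a question about the coordinates of \<open>a\<close>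
  in this moving basis.

  If \<open>\<langle>\<alpha>, a\<rangle> = \<sigma>\<close>, successive differentiation gives \<open>\<langle>T, a\<rangle> = 0\<close>,
  \<open>\<langle>N, a\<rangle> = - \<sigma> / \<kappa>\<close> and \<open>\<tau> \<langle>B, a\<rangle> = \<sigma> \<kappa>' / \<kappa>\<^sup>2\<close>.  For \<open>\<sigma> = 0\<close> a nonzero torsion would
  annihilate all coordinates of \<open>a \<noteq> 0\<close>.  For \<open>\<sigma> \<noteq> 0\<close>, computing \<open>\<langle>a, a\<rangle>\<close> from the
  coordinates is the asserted identity, because \<open>1 / H\<^sup>2 = (\<langle>a, a\<rangle> + \<sigma>\<^sup>2) / \<sigma>\<^sup>2\<close>.

  Conversely, if \<open>\<tau> = 0\<close> then \<open>B\<close> is constant and may serve as \<open>a\<close>.  In the remaining case the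
  coordinates above, for \<open>\<sigma> = 1\<close>, define the candidate
  \<open>w = - (1/\<kappa>) N + (\<kappa>' / (\<kappa>\<^sup>2 \<tau>)) B - \<alpha>\<close>.  Differentiating the hypothesis
  \<open>1/\<kappa>\<^sup>2 + (\<kappa>' / (\<kappa>\<^sup>2 \<tau>))\<^sup>2 = C\<close> and cancelling \<open>\<kappa>' \<noteq> 0\<close> gives \<open>w' = 0\<close>, and
  \<open>\<langle>w, w\<rangle> = C - 1\<close>, \<open>\<langle>\<alpha>, w\<rangle> = 1\<close>.  Normalising \<open>w\<close> yields the surface, and the sign of \<open>C - 1\<close>
  decides its type.  Differentiating the candidate takes differentiability of \<open>\<kappa>'\<close> and \<open>\<tau>\<close>, which
  class \<open>C\<^sup>4\<close> provides.
\<close>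

section \<open>The Lorentz form\<close>

lemma bounded_bilinear_lorentz: "bounded_bilinear lorentz"
  unfolding bilinear_conv_bounded_bilinear [symmetric]
  by (auto simp: bilinear_def linear_iff lorentz_def algebra_simps)

interpretation lorentz: bounded_bilinear lorentz
  by (rule bounded_bilinear_lorentz)

lemmas lorentz_linear =
  lorentz.add_left lorentz.add_right lorentz.diff_left lorentz.diff_right
  lorentz.scaleR_left lorentz.scaleR_right lorentz.minus_left lorentz.minus_right

lemma lorentz_commute: "lorentz x y = lorentz y x"
  by (simp add: lorentz_def mult.commute)

lemma has_real_derivative_lorentz:
  assumes "(u has_vector_derivative u') (at s)" "(v has_vector_derivative v') (at s)"
  shows "((\<lambda>s. lorentz (u s) (v s)) has_real_derivative lorentz u' (v s) + lorentz (u s) v') (at s)"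
  using lorentz.has_vector_derivative [OF assms]
  by (simp add: has_real_derivative_iff_has_vector_derivative add.commute)

lemma differentiable_lorentz:
  fixes u v :: "real \<Rightarrow> real^4"
  assumes "u differentiable (at s)" "v differentiable (at s)"
  shows "(\<lambda>s. lorentz (u s) (v s)) differentiable (at s)"
  using assms has_real_derivative_lorentz [of u _ s v]
  by (meson has_field_derivative_imp_has_derivative differentiable_def vector_derivative_works)

text \<open>A vector that is Lorentz-orthogonal to all rows of a matrix becomes, after a sign change in
  its last coordinate, a vector of the kernel.\<close>

lemma lorentz_nondegenerate_basis:
  assumes "det (vector [x, y, z, p] :: real^4^4) \<noteq> 0"
    and "lorentz v x = 0" "lorentz v y = 0" "lorentz v z = 0" "lorentz v p = 0"
  shows "v = 0"
proof -
  define v' :: "real^4" where "v' = (\<chi> i. if i = 4 then - v$i else v$i)"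
  define M :: "real^4^4" where "M = vector [x, y, z, p]"
  have "M *v v' = 0"
    using assms(2-5)
    by (simp add: M_def v'_def vec_eq_iff matrix_vector_mult_def forall_4 sum_4 lorentz_def
        vector_def mult.commute)
  moreover have "invertible M"
    using assms(1) by (simp add: M_def invertible_det_nz)
  ultimately have "v' = 0"
    by (metis invertible_def matrix_left_invertible_ker)
  then show ?thesis
    by (simp add: v'_def vec_eq_iff forall_4)
qed

section \<open>The moving frame in Minkowski space\<close>

locale frenet_curve =
  fixes I :: "real set" and \<alpha> T N B :: "real \<Rightarrow> real^4" and \<kappa> \<tau> :: "real \<Rightarrow> real"
  assumes curve: "arclength_curve I \<alpha>"
    and frame: "frenet_frame I \<alpha> T N B \<kappa> \<tau>"
    and kappa_pos: "s \<in> I \<Longrightarrow> \<kappa> s > 0"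
begin

lemma open_I: "open I" and convex_I: "convex I" and I_nonempty: "I \<noteq> {}"
  and alpha_in_hyp3: "s \<in> I \<Longrightarrow> \<alpha> s \<in> hyp3"
  using curve by (auto simp: arclength_curve_def is_interval_convex)

lemma frame_products:
  assumes "s \<in> I"
  shows "lorentz (\<alpha> s) (\<alpha> s) = -1" "lorentz (T s) (T s) = 1"
    "lorentz (N s) (N s) = 1" "lorentz (B s) (B s) = 1"
    "lorentz (T s) (\<alpha> s) = 0" "lorentz (N s) (\<alpha> s) = 0" "lorentz (B s) (\<alpha> s) = 0"
    "lorentz (T s) (N s) = 0" "lorentz (T s) (B s) = 0" "lorentz (N s) (B s) = 0"
    "lorentz (\<alpha> s) (T s) = 0" "lorentz (\<alpha> s) (N s) = 0" "lorentz (\<alpha> s) (B s) = 0"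
    "lorentz (N s) (T s) = 0" "lorentz (B s) (T s) = 0" "lorentz (B s) (N s) = 0"
  using assms frame alpha_in_hyp3 [OF assms]
  by (auto simp: frenet_frame_def hyp3_def lorentz_commute)

lemma frame_expansion:
  assumes "s \<in> I"
  shows "v = lorentz v (T s) *\<^sub>R T s + lorentz v (N s) *\<^sub>R N s + lorentz v (B s) *\<^sub>R B s
    - lorentz v (\<alpha> s) *\<^sub>R \<alpha> s" (is "v = ?w")
proof -
  have "v - ?w = 0"
  proof (rule lorentz_nondegenerate_basis)
    show "det (vector [T s, N s, B s, \<alpha> s] :: real^4^4) \<noteq> 0"
      using frame assms by (force simp: frenet_frame_def)
  qed (simp_all add: lorentz_linear frame_products [OF assms])
  then show ?thesis by simp
qed

lemma lorentz_square_expansion: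
  assumes "s \<in> I"
  shows "lorentz v v = (lorentz v (T s))\<^sup>2 + (lorentz v (N s))\<^sup>2 + (lorentz v (B s))\<^sup>2
    - (lorentz v (\<alpha> s))\<^sup>2"
proof -
  have "lorentz v v = lorentz v (lorentz v (T s) *\<^sub>R T s + lorentz v (N s) *\<^sub>R N s
      + lorentz v (B s) *\<^sub>R B s - lorentz v (\<alpha> s) *\<^sub>R \<alpha> s)"
    by (rule arg_cong [where f = "lorentz v", OF frame_expansion [OF assms]])
  then show ?thesis
    by (simp add: lorentz_linear power2_eq_square)
qed

lemma derivative_of_constant_on_I:
  fixes f :: "real \<Rightarrow> real"
  assumes "(f has_real_derivative f') (at s)" "s \<in> I" "\<And>t. t \<in> I \<Longrightarrow> f t = c"
  shows "f' = 0"
proof -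
  have "((\<lambda>_. c) has_real_derivative f') (at s)"
    using has_field_derivative_transform_within_open [OF assms(1) open_I] assms by simp
  then show ?thesis
    using DERIV_const DERIV_unique by blast
qed

lemma vector_constant_on_I:
  fixes V :: "real \<Rightarrow> real^4"
  assumes "\<And>s. s \<in> I \<Longrightarrow> (V has_vector_derivative 0) (at s)"
  obtains c where "\<And>s. s \<in> I \<Longrightarrow> V s = c"
  using has_vector_derivative_zero_constant [OF convex_I, of V]
    assms has_vector_derivative_at_within by blast

lemma differentiable_cong_on_I:
  assumes "f differentiable (at s)" "s \<in> I" "\<And>t. t \<in> I \<Longrightarrow> f t = g t"
  shows "g differentiable (at s)"
  using assms has_derivative_transform_within_open [OF _ open_I, of f _ s UNIV g]
  by (auto simp: differentiable_def)

lemma frame_has_vector_derivative: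
  assumes "s \<in> I"
  shows "(T has_vector_derivative vector_derivative T (at s)) (at s)"
    "(N has_vector_derivative vector_derivative N (at s)) (at s)"
    "(B has_vector_derivative vector_derivative B (at s)) (at s)"
  using frame assms by (simp_all add: frenet_frame_def vector_derivative_works)

lemma alpha_deriv: "s \<in> I \<Longrightarrow> (\<alpha> has_vector_derivative T s) (at s)"
  using curve frame
  by (simp add: arclength_curve_def frenet_frame_def numeral_eq_Suc vector_derivative_works)

text \<open>The flat derivative of a tangent field \<open>V\<close> differs from the covariant one by
  \<open>\<langle>V', \<alpha>\<rangle> \<alpha>\<close>, and \<open>\<langle>V, \<alpha>\<rangle> = 0\<close> shows \<open>\<langle>V', \<alpha>\<rangle> = - \<langle>V, T\<rangle>\<close>.\<close>

lemma flat_derivative: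
  assumes "s \<in> I" "(V has_vector_derivative V') (at s)" "\<And>t. t \<in> I \<Longrightarrow> lorentz (V t) (\<alpha> t) = 0"
  shows "V' = cov_deriv \<alpha> V s + lorentz (V s) (T s) *\<^sub>R \<alpha> s"
proof -
  have "lorentz V' (\<alpha> s) + lorentz (V s) (T s) = 0"
    using derivative_of_constant_on_I
      [OF has_real_derivative_lorentz [OF assms(2) alpha_deriv [OF assms(1)]] assms(1,3)]
    by simp
  moreover have "vector_derivative V (at s) = V'"
    using assms(2) by (rule vector_derivative_at)
  ultimately show ?thesis
    by (simp add: cov_deriv_def tproj_def scaleR_add_left [symmetric])
qed

lemma frenet_equations:
  assumes "s \<in> I"
  shows "cov_deriv \<alpha> T s = \<kappa> s *\<^sub>R N s"
    "cov_deriv \<alpha> N s = - \<kappa> s *\<^sub>R T s + \<tau> s *\<^sub>R B s"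
    "cov_deriv \<alpha> B s = - \<tau> s *\<^sub>R N s"
  using frame assms by (auto simp: frenet_frame_def)

lemma T_deriv:
  assumes "s \<in> I"
  shows "(T has_vector_derivative \<kappa> s *\<^sub>R N s + \<alpha> s) (at s)"
  using frame_has_vector_derivative(1) [OF assms]
    flat_derivative [OF assms frame_has_vector_derivative(1) [OF assms] frame_products(5)]
  by (simp add: frenet_equations [OF assms] frame_products [OF assms])

lemma N_deriv:
  assumes "s \<in> I"
  shows "(N has_vector_derivative - \<kappa> s *\<^sub>R T s + \<tau> s *\<^sub>R B s) (at s)"
  using frame_has_vector_derivative(2) [OF assms]
    flat_derivative [OF assms frame_has_vector_derivative(2) [OF assms] frame_products(6)]
  by (simp add: frenet_equations [OF assms] frame_products [OF assms])

lemma B_deriv: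
  assumes "s \<in> I"
  shows "(B has_vector_derivative - \<tau> s *\<^sub>R N s) (at s)"
  using frame_has_vector_derivative(3) [OF assms]
    flat_derivative [OF assms frame_has_vector_derivative(3) [OF assms] frame_products(7)]
  by (simp add: frenet_equations [OF assms] frame_products [OF assms])

section \<open>Differentiability of curvature and torsion\<close>

text \<open>Up to \<open>\<alpha>\<close> itself, \<open>\<kappa> N\<close> is the second derivative of \<open>\<alpha>\<close>.\<close>

lemma curvature_vector_twice_differentiable:
  obtains W where "\<And>s. s \<in> I \<Longrightarrow> ((\<lambda>s. \<kappa> s *\<^sub>R N s) has_vector_derivative W s) (at s)"
    and "\<And>s. s \<in> I \<Longrightarrow> W differentiable (at s)"
proof
  let ?D = "\<lambda>f :: real \<Rightarrow> real^4. \<lambda>s. vector_derivative f (at s)"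
  have diff: "?D \<alpha> differentiable (at s)" "?D (?D \<alpha>) differentiable (at s)"
    "?D (?D (?D \<alpha>)) differentiable (at s)" if "s \<in> I" for s
    using curve that by (auto simp: arclength_curve_def numeral_eq_Suc)
  have D1: "T s = ?D \<alpha> s" if "s \<in> I" for s
    using frame that by (simp add: frenet_frame_def)
  have D2: "?D (?D \<alpha>) s - \<alpha> s = \<kappa> s *\<^sub>R N s" if "s \<in> I" for s
  proof -
    have "(?D \<alpha> has_vector_derivative \<kappa> s *\<^sub>R N s + \<alpha> s) (at s)"
      by (rule has_vector_derivative_transform_within_open [OF T_deriv [OF that] open_I that D1])
    then show ?thesis
      by (simp add: vector_derivative_at)
  qed
  fix s assume s: "s \<in> I"
  have "((\<lambda>s. ?D (?D \<alpha>) s - \<alpha> s) has_vector_derivative ?D (?D (?D \<alpha>)) s - ?D \<alpha> s) (at s)"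
    using diff(2) [OF s] alpha_deriv [OF s] D1 [OF s]
    by (intro has_vector_derivative_diff) (simp_all add: vector_derivative_works)
  then show "((\<lambda>s. \<kappa> s *\<^sub>R N s) has_vector_derivative ?D (?D (?D \<alpha>)) s - ?D \<alpha> s) (at s)"
    by (rule has_vector_derivative_transform_within_open [OF _ open_I s D2])
  show "(\<lambda>s. ?D (?D (?D \<alpha>)) s - ?D \<alpha> s) differentiable (at s)"
    by (intro differentiable_diff diff [OF s])
qed

text \<open>With \<open>W = (\<kappa> N)'\<close>, the Frenet equations give \<open>\<kappa>' = \<langle>W, N\<rangle>\<close> and \<open>\<kappa> \<tau> = \<langle>W, B\<rangle>\<close>, and the
  right-hand sides are differentiable.\<close>

lemma curvature_torsion_differentiable:
  assumes "s \<in> I"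
  shows "(\<kappa> has_real_derivative deriv \<kappa> s) (at s)"
    and "deriv \<kappa> differentiable (at s)"
    and "\<tau> differentiable (at s)"
proof -
  obtain W where W: "\<And>s. s \<in> I \<Longrightarrow> ((\<lambda>s. \<kappa> s *\<^sub>R N s) has_vector_derivative W s) (at s)"
    and W_diff: "\<And>s. s \<in> I \<Longrightarrow> W differentiable (at s)"
    using curvature_vector_twice_differentiable by blast
  have NB_diff: "N differentiable (at s)" "B differentiable (at s)"
    using frame assms by (simp_all add: frenet_frame_def)
  have kappa: "(\<kappa> has_real_derivative lorentz (W s) (N s)) (at s)" if "s \<in> I" for s
  proof -
    have "((\<lambda>s. lorentz (\<kappa> s *\<^sub>R N s) (N s)) has_real_derivative lorentz (W s) (N s)) (at s)"
      using has_real_derivative_lorentz [OF W [OF that] N_deriv [OF that]]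
      by (simp add: lorentz_linear frame_products [OF that])
    then show ?thesis
      by (rule has_field_derivative_transform_within_open [OF _ open_I that])
         (simp add: lorentz_linear frame_products)
  qed
  have deriv: "lorentz (W s) (N s) = deriv \<kappa> s" if "s \<in> I" for s
    using DERIV_imp_deriv [OF kappa [OF that]] by simp
  then show "(\<kappa> has_real_derivative deriv \<kappa> s) (at s)"
    using kappa [OF assms] deriv [OF assms] by simp
  then have kappa_diff: "\<kappa> differentiable (at s)"
    using real_differentiable_def by blast
  show "deriv \<kappa> differentiable (at s)"
    using differentiable_cong_on_I
      [OF differentiable_lorentz [OF W_diff [OF assms] NB_diff(1)] assms] deriv
    by simp
  have torsion: "lorentz (W s) (B s) / \<kappa> s = \<tau> s" if "s \<in> I" for s
  proof -
    have "lorentz (W s) (B s) - \<kappa> s * \<tau> s = 0"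
      using derivative_of_constant_on_I
        [OF has_real_derivative_lorentz [OF W [OF that] B_deriv [OF that]] that, of 0]
      by (simp add: lorentz_linear frame_products that)
    then show ?thesis
      using kappa_pos [OF that] by (simp add: field_simps)
  qed
  have "(\<lambda>s. lorentz (W s) (B s) / \<kappa> s) differentiable (at s)"
    using kappa_pos [OF assms]
    by (intro differentiable_divide differentiable_lorentz W_diff assms NB_diff kappa_diff) simp
  then show "\<tau> differentiable (at s)"
    by (rule differentiable_cong_on_I [OF _ assms torsion])
qed

section \<open>Curves in an umbilical surface\<close>

text \<open>Each equation is the derivative of the one before it along the Frenet system.  The last
  keeps \<open>\<tau>\<close> on the left so that it also covers parameters where the torsion vanishes; for
  \<open>\<sigma> = 0\<close> it forces \<open>\<tau> = 0\<close> or \<open>\<langle>a, B\<rangle> = 0\<close>.\<close>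

lemma coordinates_of_axis:
  assumes "\<alpha> ` I \<subseteq> umb a \<sigma>" "s \<in> I"
  shows "lorentz a (\<alpha> s) = \<sigma>" "lorentz a (T s) = 0" "lorentz a (N s) = - \<sigma> / \<kappa> s"
    "\<tau> s * lorentz a (B s) = \<sigma> * deriv \<kappa> s / (\<kappa> s)\<^sup>2"
proof -
  have deriv_a: "((\<lambda>s. lorentz a (V s)) has_real_derivative lorentz a V') (at s)"
    if "(V has_vector_derivative V') (at s)" for V V' s
    using has_real_derivative_lorentz [OF has_vector_derivative_const that, of a]
    by (simp add: lorentz.zero_left)
  have 0: "lorentz a (\<alpha> s) = \<sigma>" if "s \<in> I" for s
    using assms(1) that by (auto simp: umb_def lorentz_commute)
  have 1: "lorentz a (T s) = 0" if "s \<in> I" for s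
    using derivative_of_constant_on_I [OF deriv_a [OF alpha_deriv [OF that]] that] 0 by blast
  have "\<kappa> s * lorentz a (N s) + \<sigma> = 0" if "s \<in> I" for s
    using derivative_of_constant_on_I [OF deriv_a [OF T_deriv [OF that]] that, of 0] 1 0 that
    by (simp add: lorentz_linear)
  then have 2: "lorentz a (N s) = - \<sigma> / \<kappa> s" if "s \<in> I" for s
    using kappa_pos [OF that] that by (simp add: field_simps eq_neg_iff_add_eq_0)
  have "((\<lambda>s. lorentz a (N s) + \<sigma> / \<kappa> s) has_real_derivative
      \<tau> s * lorentz a (B s) - \<sigma> * deriv \<kappa> s / (\<kappa> s)\<^sup>2) (at s)"
    using kappa_pos [OF assms(2)] 1 [OF assms(2)]
    by (auto intro!: derivative_eq_intros deriv_a [OF N_deriv [OF assms(2)]]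
        curvature_torsion_differentiable(1) [OF assms(2)] simp: lorentz_linear power2_eq_square)
  from derivative_of_constant_on_I [OF this assms(2), of 0]
  show "\<tau> s * lorentz a (B s) = \<sigma> * deriv \<kappa> s / (\<kappa> s)\<^sup>2"
    using 2 by simp
  show "lorentz a (\<alpha> s) = \<sigma>" "lorentz a (T s) = 0" "lorentz a (N s) = - \<sigma> / \<kappa> s"
    using 0 1 2 assms(2) by auto
qed

lemma torsion_zero_in_geodesic_plane:
  assumes "\<alpha> ` I \<subseteq> umb a 0" "a \<noteq> 0" "s \<in> I"
  shows "\<tau> s = 0"
proof (rule ccontr)
  note coord = coordinates_of_axis [OF assms(1,3)]
  assume "\<tau> s \<noteq> 0"
  then have "lorentz a (B s) = 0"
    using coord(4) by simp
  then have "lorentz a (T s) *\<^sub>R T s + lorentz a (N s) *\<^sub>R N s + lorentz a (B s) *\<^sub>R B s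
      - lorentz a (\<alpha> s) *\<^sub>R \<alpha> s = 0"
    by (simp add: coord(1-3))
  then show False
    using frame_expansion [OF assms(3), of a] assms(2) by metis
qed

lemma axis_norm:
  assumes "\<alpha> ` I \<subseteq> umb a \<sigma>" "s \<in> I" "\<tau> s \<noteq> 0"
  shows "lorentz a a + \<sigma>\<^sup>2 = \<sigma>\<^sup>2 * (1 / (\<kappa> s)\<^sup>2 + (deriv \<kappa> s)\<^sup>2 / ((\<kappa> s)^4 * (\<tau> s)\<^sup>2))"
proof -
  note coord = coordinates_of_axis [OF assms(1,2)]
  have "lorentz a (B s) = \<sigma> * deriv \<kappa> s / ((\<kappa> s)\<^sup>2 * \<tau> s)"
    using coord(4) assms(3) by (metis divide_divide_eq_left nonzero_mult_div_cancel_left)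
  then show ?thesis
    using lorentz_square_expansion [OF assms(2), of a] coord
    by (simp add: power_divide power_mult_distrib distrib_left flip: power_mult)
qed

section \<open>Construction of the umbilical surface\<close>

lemma geodesic_plane_if_torsion_zero:
  assumes "\<And>s. s \<in> I \<Longrightarrow> \<tau> s = 0"
  obtains b where "lorentz b b = 1" "\<alpha> ` I \<subseteq> umb b 0"
proof -
  obtain b where b: "\<And>s. s \<in> I \<Longrightarrow> B s = b"
    using vector_constant_on_I [of B] B_deriv assms by fastforce
  have "lorentz b b = 1"
    using I_nonempty b frame_products(4) by blast
  moreover have "\<alpha> ` I \<subseteq> umb b 0"
    using b frame_products(13) alpha_in_hyp3 by (auto simp: umb_def)
  ultimately show thesis
    by (rule that)
qed

text \<open>In terms of \<open>f = 1/\<kappa>\<close> and \<open>g = \<kappa>' / (\<kappa>\<^sup>2 \<tau>)\<close> the hypothesis says that \<open>(f, g)\<close> moves on a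
  circle.  Since \<open>f' = - \<tau> g\<close> by definition, \<open>g \<noteq> 0\<close> forces \<open>g' = \<tau> f\<close>: the pair rotates with
  angular speed \<open>\<tau>\<close>, exactly opposite to the rotation of \<open>(N, B)\<close>, so that only the tangential
  terms of \<open>(g B - f N)'\<close> survive, and \<open>\<alpha>' = T\<close> cancels them.\<close>

lemma constant_axis:
  assumes nz: "\<And>s. s \<in> I \<Longrightarrow> \<tau> s \<noteq> 0 \<and> deriv \<kappa> s \<noteq> 0"
    and C: "\<And>s. s \<in> I \<Longrightarrow> 1 / (\<kappa> s)\<^sup>2 + (deriv \<kappa> s)\<^sup>2 / ((\<kappa> s)^4 * (\<tau> s)\<^sup>2) = C"
  obtains w where "\<alpha> ` I \<subseteq> umb w 1" "lorentz w w = C - 1"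
proof -
  define f where "f = (\<lambda>s. 1 / \<kappa> s)"
  define g where "g = (\<lambda>s. deriv \<kappa> s / ((\<kappa> s)\<^sup>2 * \<tau> s))"
  define w where "w = (\<lambda>s. g s *\<^sub>R B s - f s *\<^sub>R N s - \<alpha> s)"
  have fg: "(f s)\<^sup>2 + (g s)\<^sup>2 = C" if "s \<in> I" for s
    using C [OF that]
    by (simp add: f_def g_def power_divide power_mult_distrib flip: power_mult)
  have w_deriv: "(w has_vector_derivative 0) (at s)" if s: "s \<in> I" for s
  proof -
    have k: "\<kappa> s > 0" and t: "\<tau> s \<noteq> 0" and g_nz: "g s \<noteq> 0"
      using kappa_pos [OF s] nz [OF s] by (auto simp: g_def)
    have f': "(f has_real_derivative - \<tau> s * g s) (at s)"
      unfolding f_def using k t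
      by (auto intro!: derivative_eq_intros curvature_torsion_differentiable(1) [OF s]
          simp: g_def power2_eq_square)
    have kappa_diff: "\<kappa> differentiable (at s)"
      using curvature_torsion_differentiable(1) [OF s] real_differentiable_def by blast
    have "g differentiable (at s)"
      unfolding g_def using k t
      by (intro differentiable_divide differentiable_mult differentiable_power
          kappa_diff curvature_torsion_differentiable(2,3) [OF s]) auto
    then obtain g' where g': "(g has_real_derivative g') (at s)"
      using real_differentiable_def by blast
    have "((\<lambda>s. (f s)\<^sup>2 + (g s)\<^sup>2) has_real_derivative 2 * g s * (g' - \<tau> s * f s)) (at s)"
      by (auto intro!: derivative_eq_intros f' g' simp: algebra_simps)
    from derivative_of_constant_on_I [OF this s fg] have "g' = \<tau> s * f s"
      using g_nz by simp
    moreover have "(w has_vector_derivative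
        (g s *\<^sub>R (- \<tau> s *\<^sub>R N s) + g' *\<^sub>R B s)
        - (f s *\<^sub>R (- \<kappa> s *\<^sub>R T s + \<tau> s *\<^sub>R B s) + (- \<tau> s * g s) *\<^sub>R N s) - T s) (at s)"
      unfolding w_def
      by (intro has_vector_derivative_diff has_vector_derivative_scaleR
          f' g' B_deriv [OF s] N_deriv [OF s] alpha_deriv [OF s])
    ultimately show ?thesis
      using k by (simp add: f_def algebra_simps)
  qed
  obtain c where c: "\<And>s. s \<in> I \<Longrightarrow> w s = c"
    using vector_constant_on_I [OF w_deriv] by blast
  have "lorentz (\<alpha> s) (w s) = 1" "lorentz (w s) (w s) = C - 1" if "s \<in> I" for s
    using fg [OF that]
    by (simp_all add: w_def lorentz_linear frame_products [OF that] power2_eq_square)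
  with c I_nonempty have "\<alpha> ` I \<subseteq> umb c 1" "lorentz c c = C - 1"
    using alpha_in_hyp3 by (auto simp: umb_def)
  then show thesis
    by (rule that)
qed

end

text \<open>With \<open>a = \<sigma> w\<close> the condition \<open>\<langle>p, w\<rangle> = 1\<close> becomes \<open>\<langle>p, a\<rangle> = \<sigma>\<close>, and
  \<open>\<langle>a, a\<rangle> + \<sigma>\<^sup>2 = \<sigma>\<^sup>2 C\<close>, so \<open>H = 1 / sqrt C\<close> for every \<open>\<sigma> > 0\<close>.  Taking
  \<open>\<sigma> = 1 / sqrt \<bar>C - 1\<bar>\<close> when \<open>C \<noteq> 1\<close> makes \<open>\<langle>a, a\<rangle>\<close> equal to \<open>1\<close> or \<open>-1\<close>; for \<open>0 < C < 1\<close>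
  this \<open>\<sigma>\<close> exceeds \<open>1\<close>, as a geodesic sphere requires.\<close>

lemma normalize_axis:
  assumes "umb w 1 \<noteq> {}" "lorentz w w = C - 1" "C > 0"
  obtains a \<sigma> H where "totally_umbilical a \<sigma>" "has_mean_curvature a \<sigma> H" "umb w 1 \<subseteq> umb a \<sigma>"
    "C = 1 / H\<^sup>2" "C > 1 \<longrightarrow> equidistant_surface a \<sigma>" "C = 1 \<longrightarrow> horosphere a \<sigma>"
    "C < 1 \<longrightarrow> geodesic_sphere a \<sigma>"
proof -
  define \<sigma> where "\<sigma> = (if C = 1 then 1 else 1 / sqrt \<bar>C - 1\<bar>)"
  define a where "a = \<sigma> *\<^sub>R w"
  have pos: "\<sigma> > 0"
    by (simp add: \<sigma>_def)
  have sq: "\<sigma>\<^sup>2 = (if C = 1 then 1 else 1 / \<bar>C - 1\<bar>)"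
    by (simp add: \<sigma>_def power_divide)
  have aa: "lorentz a a = \<sigma>\<^sup>2 * (C - 1)"
    by (simp add: a_def lorentz_linear assms(2) power2_eq_square)
  then have norm: "lorentz a a + \<sigma>\<^sup>2 = \<sigma>\<^sup>2 * C"
    by (simp add: algebra_simps)
  have sub: "umb w 1 \<subseteq> umb a \<sigma>"
    by (auto simp: umb_def a_def lorentz_linear)
  have "w \<noteq> 0"
    using assms(1) by (auto simp: umb_def lorentz.zero_right)
  then have "a \<noteq> 0"
    using pos by (simp add: a_def)
  have eq: "C > 1 \<longrightarrow> equidistant_surface a \<sigma>"
    using aa sq pos by (auto simp: equidistant_surface_def)
  have ho: "C = 1 \<longrightarrow> horosphere a \<sigma>"
    using aa pos by (auto simp: horosphere_def)
  have sp: "C < 1 \<longrightarrow> geodesic_sphere a \<sigma>"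
  proof
    assume "C < 1"
    then have "\<sigma>\<^sup>2 > 1"
      using assms(3) by (simp add: sq)
    then have "\<sigma> > 1"
      using pos power_le_one [of \<sigma> 2] by linarith
    moreover have "lorentz a a = -1"
      using \<open>C < 1\<close> unfolding aa sq by (simp add: divide_simps)
    ultimately show "geodesic_sphere a \<sigma>"
      by (simp add: geodesic_sphere_def)
  qed
  have tu: "totally_umbilical a \<sigma>"
    using \<open>a \<noteq> 0\<close> sub assms(1) eq ho sp by (auto simp: totally_umbilical_def)
  define H where "H = \<sigma> / sqrt (lorentz a a + \<sigma>\<^sup>2)"
  have "C = 1 / H\<^sup>2"
    using pos assms(3) by (simp add: H_def norm power_divide)
  then show thesis
    using that tu has_mean_curvature_iff [OF tu] sub eq ho sp H_def by blast
qed

theorem theorem1p1: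
  fixes I :: "real set" and \<alpha> :: "real \<Rightarrow> real^4" and \<kappa> \<tau> :: "real \<Rightarrow> real"
  assumes "arclength_curve I \<alpha>"
    and "has_curvature_torsion I \<alpha> \<kappa> \<tau>"
  shows "(\<forall>a \<sigma>. totally_umbilical a \<sigma> \<and> \<sigma> = 0 \<and> \<alpha> ` I \<subseteq> umb a \<sigma>
           \<longrightarrow> (\<forall>s\<in>I. \<tau> s = 0))
    \<and> (\<forall>a \<sigma> H. totally_umbilical a \<sigma> \<and> has_mean_curvature a \<sigma> H \<and> \<sigma> \<noteq> 0
             \<and> \<alpha> ` I \<subseteq> umb a \<sigma> \<and> (\<forall>s\<in>I. \<tau> s \<noteq> 0)
           \<longrightarrow> (\<forall>s\<in>I. 1 / (\<kappa> s)^2 + (deriv \<kappa> s)^2 / ((\<kappa> s)^4 * (\<tau> s)^2) = 1 / H^2))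
    \<and> ((\<forall>s\<in>I. \<tau> s = 0)
           \<longrightarrow> (\<exists>a \<sigma>. totally_umbilical a \<sigma> \<and> geodesic_plane a \<sigma> \<and> \<alpha> ` I \<subseteq> umb a \<sigma>))
    \<and> (\<forall>C. (\<forall>s\<in>I. \<tau> s \<noteq> 0 \<and> deriv \<kappa> s \<noteq> 0) \<and> C > 0
             \<and> (\<forall>s\<in>I. 1 / (\<kappa> s)^2 + (deriv \<kappa> s)^2 / ((\<kappa> s)^4 * (\<tau> s)^2) = C)
           \<longrightarrow> (\<exists>a \<sigma> H. totally_umbilical a \<sigma> \<and> has_mean_curvature a \<sigma> H
                  \<and> \<alpha> ` I \<subseteq> umb a \<sigma> \<and> C = 1 / H^2
                  \<and> (C > 1 \<longrightarrow> equidistant_surface a \<sigma>)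
                  \<and> (C = 1 \<longrightarrow> horosphere a \<sigma>)
                  \<and> (C < 1 \<longrightarrow> geodesic_sphere a \<sigma>)))"
proof -
  obtain T N B where "frenet_frame I \<alpha> T N B \<kappa> \<tau>" "\<forall>s\<in>I. \<kappa> s > 0"
    using assms(2) by (auto simp: has_curvature_torsion_def)
  then interpret frenet_curve I \<alpha> T N B \<kappa> \<tau>
    using assms(1) by unfold_locales auto
  show ?thesis
  proof (intro conjI allI impI ballI; (elim conjE)?)
    fix a \<sigma> s
    assume "totally_umbilical a \<sigma>" "\<sigma> = 0" "\<alpha> ` I \<subseteq> umb a \<sigma>" "s \<in> I"
    then show "\<tau> s = 0"
      using torsion_zero_in_geodesic_plane by (auto simp: totally_umbilical_def)
  next
    fix a \<sigma> H s
    assume tu: "totally_umbilical a \<sigma>" and H: "has_mean_curvature a \<sigma> H" and "\<sigma> \<noteq> 0"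
      and sub: "\<alpha> ` I \<subseteq> umb a \<sigma>" and "\<forall>s\<in>I. \<tau> s \<noteq> 0" and s: "s \<in> I"
    then have norm: "lorentz a a + \<sigma>\<^sup>2
        = \<sigma>\<^sup>2 * (1 / (\<kappa> s)\<^sup>2 + (deriv \<kappa> s)\<^sup>2 / ((\<kappa> s)^4 * (\<tau> s)\<^sup>2))"
      by (intro axis_norm) auto
    have "lorentz a a + \<sigma>\<^sup>2 \<ge> 0"
      unfolding norm by simp
    moreover have "H = \<sigma> / sqrt (lorentz a a + \<sigma>\<^sup>2)"
      using H has_mean_curvature_iff [OF tu] by blast
    ultimately have "1 / H\<^sup>2 = (lorentz a a + \<sigma>\<^sup>2) / \<sigma>\<^sup>2"
      by (simp add: power_divide)
    then show "1 / (\<kappa> s)^2 + (deriv \<kappa> s)^2 / ((\<kappa> s)^4 * (\<tau> s)^2) = 1 / H^2"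
      using \<open>\<sigma> \<noteq> 0\<close> by (simp add: norm)
  next
    assume "\<forall>s\<in>I. \<tau> s = 0"
    then obtain b where "lorentz b b = 1" "\<alpha> ` I \<subseteq> umb b 0"
      using geodesic_plane_if_torsion_zero by blast
    moreover from this have "totally_umbilical b 0"
      using I_nonempty
      by (auto simp: totally_umbilical_def geodesic_plane_def lorentz.zero_left)
    ultimately show "\<exists>a \<sigma>. totally_umbilical a \<sigma> \<and> geodesic_plane a \<sigma> \<and> \<alpha> ` I \<subseteq> umb a \<sigma>"
      by (auto simp: geodesic_plane_def)
  next
    fix C :: real
    assume "\<forall>s\<in>I. \<tau> s \<noteq> 0 \<and> deriv \<kappa> s \<noteq> 0" "C > 0"
      "\<forall>s\<in>I. 1 / (\<kappa> s)^2 + (deriv \<kappa> s)^2 / ((\<kappa> s)^4 * (\<tau> s)^2) = C"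
    then obtain w where w: "\<alpha> ` I \<subseteq> umb w 1" "lorentz w w = C - 1"
      using constant_axis by blast
    moreover have "umb w 1 \<noteq> {}"
      using w(1) I_nonempty by blast
    ultimately show "\<exists>a \<sigma> H. totally_umbilical a \<sigma> \<and> has_mean_curvature a \<sigma> H
        \<and> \<alpha> ` I \<subseteq> umb a \<sigma> \<and> C = 1 / H^2
        \<and> (C > 1 \<longrightarrow> equidistant_surface a \<sigma>)
        \<and> (C = 1 \<longrightarrow> horosphere a \<sigma>)
        \<and> (C < 1 \<longrightarrow> geodesic_sphere a \<sigma>)"
      using normalize_axis [of w C] \<open>C > 0\<close> by (metis subset_trans)
  qed
qed

end
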